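(* For positive integers $m,n$ and any integer $p\le \min\{m,n\}$, the number of spanning trees of $K_{m,n}-pK_2$ is $$\tau(K_{m,n}-pK_2)=(mn-m-n+p)(mn-m-n)^{p-1}m^{n-p-1}n^{m-p-1}.$$
   Context: $K_{m,n}-pK_2$ denotes the graph obtained from the complete bipartite graph $K_{m,n}$ by deleting the edges of a matching of size $p$ (a "nearly complete bipartite graph"). $\tau(G)$ is the number of spanning trees of $G$.
   Formalization: For m=n=2, p=0 the printed product (mn-m-n+p)(mn-m-n)^{p-1} is 0·0^{-1}, which is undefined; there it is read as 1 (its value for all other m,n with p=0), giving τ(K_{2,2})=4. Also p is taken to be nonnegative, being the size of a matching. *)

theory Defs
  imports Complex_Main
begin

text \<open>Finite simple graphs are given by a vertex set and a set of two-element subsets of it.\<close>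

definition simple_graph :: "'a set \<Rightarrow> 'a set set \<Rightarrow> bool" where
  "simple_graph V E \<longleftrightarrow> finite V \<and> E \<subseteq> {{u, v} | u v. u \<in> V \<and> v \<in> V \<and> u \<noteq> v}"

definition graph_connected :: "'a set \<Rightarrow> 'a set set \<Rightarrow> bool" where
  "graph_connected V E \<longleftrightarrow>
     V \<noteq> {} \<and> (\<forall>u\<in>V. \<forall>v\<in>V. (u, v) \<in> {(x, y). {x, y} \<in> E}\<^sup>*)"

text \<open>A cycle is listed without repeating its first vertex at the end.\<close>

definition graph_cycle :: "'a set set \<Rightarrow> 'a list \<Rightarrow> bool" where
  "graph_cycle E vs \<longleftrightarrow> 3 \<le> length vs \<and> distinct vs \<and>
     (\<forall>i<length vs. {vs ! i, vs ! (Suc i mod length vs)} \<in> E)"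

definition is_tree :: "'a set \<Rightarrow> 'a set set \<Rightarrow> bool" where
  "is_tree V E \<longleftrightarrow> simple_graph V E \<and> graph_connected V E \<and> (\<nexists>vs. graph_cycle E vs)"

text \<open>A spanning tree contains all vertices, so it is determined by its edge set.\<close>

definition num_spanning_trees :: "'a set \<Rightarrow> 'a set set \<Rightarrow> nat" where
  "num_spanning_trees V E = card {T. T \<subseteq> E \<and> is_tree V T}"

definition complete_bipartite_edges :: "'a set \<Rightarrow> 'a set \<Rightarrow> 'a set set" where
  "complete_bipartite_edges A B = {{a, b} | a b. a \<in> A \<and> b \<in> B}"

definition graph_matching :: "'a set set \<Rightarrow> 'a set set \<Rightarrow> bool" where
  "graph_matching E M \<longleftrightarrow> M \<subseteq> E \<and> pairwise disjnt M"

end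

theory Submission
  imports Defs "Jordan_Normal_Form.Determinant"
begin

text \<open>
  Rooting a spanning tree identifies it with an acyclic parent function, and expanding the
  determinant of the Laplacian row by row shows that these are counted by the determinant of the
  Laplacian \<open>L\<close> with the root row replaced by a unit vector. As rows and columns of \<open>L\<close> sum to
  \<open>0\<close>, \<open>det (L + u v\<^sup>T) = (\<Sum>u) (\<Sum>v) \<tau>\<close>. Taking for \<open>u\<close> and \<open>v\<close> the indicators of the two
  sides \<open>A\<close> and \<open>B\<close>, \<open>m n \<tau>\<close> is the determinant of \<open>M\<^sub>0 - 1\<^sub>B 1\<^sub>A\<^sup>T\<close>, where \<open>M\<^sub>0\<close> consists of
  diagonal entries and of the \<open>2 \<times> 2\<close> blocks \<open>[[n - 1, 1], [1, m - 1]]\<close>, one for each deleted edge.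
  These blocks have determinant \<open>\<Delta> = m n - m - n\<close>, so
  \<open>det M\<^sub>0 = n\<^bsup>m-p\<^esup> m\<^bsup>n-p\<^esup> \<Delta>\<^bsup>p\<^esup>\<close>, and the rank-one term contributes the factor \<open>1 + p / \<Delta>\<close>.
\<close>

section \<open>Spanning trees as parent functions\<close>

text \<open>The walk grows step by step and is cut back whenever its new endpoint was visited
  before. Distinctness is what \<open>graph_cycle\<close> demands.\<close>

lemma rtrancl_distinct_walk:
  assumes "(x, y) \<in> R\<^sup>*"
  shows "\<exists>vs. vs \<noteq> [] \<and> hd vs = x \<and> last vs = y \<and> distinct vs \<and>
    (\<forall>i. Suc i < length vs \<longrightarrow> (vs ! i, vs ! Suc i) \<in> R)"
  using assms
proof (induction rule: rtrancl_induct)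
  case base
  show ?case by (rule exI[of _ "[x]"]) simp
next
  case (step y z)
  then obtain vs where vs: "vs \<noteq> []" "hd vs = x" "last vs = y" "distinct vs"
    "\<And>i. Suc i < length vs \<Longrightarrow> (vs ! i, vs ! Suc i) \<in> R"
    by blast
  show ?case
  proof (cases "z \<in> set vs")
    case True
    then obtain k where k: "k < length vs" "vs ! k = z"
      by (metis in_set_conv_nth)
    let ?ws = "take (Suc k) vs"
    have "last ?ws = z" using k by (simp add: take_Suc_conv_app_nth)
    moreover have "hd ?ws = x" using vs(1,2) by (cases vs) auto
    ultimately show ?thesis
      using vs k by (intro exI[of _ ?ws]) (auto simp: distinct_take)
  next
    case False
    have "((vs @ [z]) ! i, (vs @ [z]) ! Suc i) \<in> R" if "Suc i < length (vs @ [z])" for i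
    proof (cases "Suc i < length vs")
      case True
      then show ?thesis using vs(5)[of i] by (simp add: nth_append)
    next
      case False
      then have i: "i = length vs - 1" "i < length vs" using that vs(1) by auto
      then have "vs ! i = y" using vs(1,3) by (simp add: last_conv_nth)
      then show ?thesis using i step.hyps(2) vs(1) by (simp add: nth_append)
    qed
    then show ?thesis
      using vs False by (intro exI[of _ "vs @ [z]"]) (auto simp: hd_append)
  qed
qed

text \<open>The edge closes a repetition-free walk that avoids it. Three vertices are present: one
  would force \<open>x = y\<close>, two would make the walk the avoided edge itself.\<close>

lemma graph_cycle_if_edge_redundant:
  assumes "{x, y} \<in> T" "x \<noteq> y" "(x, y) \<in> {(u, v). {u, v} \<in> T - {{x, y}}}\<^sup>*"
  shows "\<exists>vs. graph_cycle T vs"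
proof -
  obtain vs where vs: "vs \<noteq> []" "hd vs = x" "last vs = y" "distinct vs"
    "\<And>i. Suc i < length vs \<Longrightarrow> {vs ! i, vs ! Suc i} \<in> T - {{x, y}}"
    using rtrancl_distinct_walk[OF assms(3)] by blast
  have h: "vs ! 0 = x" "vs ! (length vs - 1) = y"
    using vs by (auto simp: hd_conv_nth last_conv_nth)
  have "length vs \<noteq> 1" using h assms(2) by auto
  moreover have "length vs \<noteq> 2" using h vs(5)[of 0] by auto
  ultimately have l: "3 \<le> length vs" using vs(1)
    by (metis One_nat_def Suc_1 length_0_conv less_2_cases not_less numeral_3_eq_3 less_Suc_eq)
  have "{vs ! i, vs ! (Suc i mod length vs)} \<in> T" if "i < length vs" for i
  proof (cases "Suc i < length vs")
    case True
    then show ?thesis using vs(5)[of i] by simp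
  next
    case False
    then have "i = length vs - 1" "Suc i = length vs" using that by auto
    then show ?thesis using h assms(1) by (simp add: insert_commute)
  qed
  then show ?thesis using l vs(4) unfolding graph_cycle_def by blast
qed

text \<open>The rank \<open>d\<close> decreasing along \<open>f\<close> says that iterating \<open>f\<close> from any vertex ends in the root
  \<open>r\<close>. Fixing \<open>r\<close> and everything outside \<open>V\<close> makes \<open>f\<close> determined by the parents.\<close>

definition parent_functions :: "'a set \<Rightarrow> 'a set set \<Rightarrow> 'a \<Rightarrow> ('a \<Rightarrow> 'a) set" where
  "parent_functions V E r = {f. f r = r \<and> (\<forall>v. v \<notin> V \<longrightarrow> f v = v) \<and>
     (\<forall>v\<in>V - {r}. {v, f v} \<in> E) \<and> (\<exists>d :: 'a \<Rightarrow> nat. \<forall>v\<in>V - {r}. d (f v) < d v)}"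

text \<open>Following parents lowers the rank until \<open>r\<close> is reached, whence
  connectedness. On a cycle, a vertex of maximal rank would have its parent as both
  neighbours.\<close>

lemma parent_edges_is_tree:
  assumes "simple_graph V E" "r \<in> V" "f \<in> parent_functions V E r"
  shows "is_tree V ((\<lambda>v. {v, f v}) ` (V - {r}))"
proof -
  let ?T = "(\<lambda>v. {v, f v}) ` (V - {r})"
  let ?R = "{(x, y). {x, y} \<in> ?T}"
  obtain d :: "'a \<Rightarrow> nat" where d: "\<And>v. v \<in> V - {r} \<Longrightarrow> d (f v) < d v"
    using assms(3) unfolding parent_functions_def by blast
  have E: "{v, f v} \<in> E" if "v \<in> V - {r}" for v
    using assms(3) that unfolding parent_functions_def by blast
  have fV: "f v \<in> V" if "v \<in> V - {r}" for v
    using E[OF that] assms(1) unfolding simple_graph_def by (auto simp: doubleton_eq_iff)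
  have sg: "simple_graph V ?T"
    using E assms(1) unfolding simple_graph_def by blast
  have root: "(v, r) \<in> ?R\<^sup>*" if "v \<in> V" for v
    using that
  proof (induction "d v" arbitrary: v rule: less_induct)
    case less
    show ?case
    proof (cases "v = r")
      case False
      then have v: "v \<in> V - {r}" using less.prems by blast
      then have "(f v, r) \<in> ?R\<^sup>*" using less.hyps d fV by blast
      moreover have "(v, f v) \<in> ?R" using v by blast
      ultimately show ?thesis by (rule converse_rtrancl_into_rtrancl[rotated])
    qed simp
  qed
  have "sym ?R" by (auto simp: sym_def insert_commute)
  then have "sym (?R\<^sup>*)" by (rule sym_rtrancl)
  then have "graph_connected V ?T"
    using root assms(2) rtrancl_trans[OF root symD[OF _ root]] unfolding graph_connected_def
    by blast
  moreover have "\<not> graph_cycle ?T vs" for vs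
  proof
    assume c: "graph_cycle ?T vs"
    let ?l = "length vs"
    have l: "3 \<le> ?l" "distinct vs" and e: "\<And>i. i < ?l \<Longrightarrow> {vs ! i, vs ! (Suc i mod ?l)} \<in> ?T"
      using c unfolding graph_cycle_def by auto
    define i where "i = (ARG_MAX (\<lambda>i. d (vs ! i)) i. i < ?l)"
    have i: "i < ?l" and mx: "\<And>j. j < ?l \<Longrightarrow> d (vs ! j) \<le> d (vs ! i)"
    proof -
      have "i < ?l \<and> (\<forall>j. j < ?l \<longrightarrow> d (vs ! j) \<le> d (vs ! i))"
        unfolding i_def
        by (rule arg_max_nat_lemma[where b = "Suc (Max ((\<lambda>i. d (vs ! i)) ` {..<?l}))" and k = 0])
           (use l in \<open>auto simp: less_Suc_eq_le\<close>)
      then show "i < ?l" "\<And>j. j < ?l \<Longrightarrow> d (vs ! j) \<le> d (vs ! i)" by auto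
    qed
    \<comment> \<open>The only edge at \<open>vs ! i\<close> leading to a vertex of no larger rank is the one to its parent,
       so the two cycle neighbours of \<open>vs ! i\<close> coincide.\<close>
    have key: "x = f (vs ! i)" if "{vs ! i, x} \<in> ?T" "d x \<le> d (vs ! i)" for x
      using that d by (fastforce simp: doubleton_eq_iff)
    \<comment> \<open>Cyclic successor and predecessor of \<open>i\<close>; they differ because the
      cycle has at least three vertices.\<close>
    define j k where "j = Suc i mod ?l" and "k = (if i = 0 then ?l - 1 else i - 1)"
    have jk: "j < ?l" "k < ?l" "j \<noteq> k" "Suc k mod ?l = i"
      using i l by (auto simp: j_def k_def mod_Suc)
    have "{vs ! i, vs ! j} \<in> ?T" using e[OF i] by (simp add: j_def)
    moreover have "{vs ! i, vs ! k} \<in> ?T" using e[OF jk(2)] jk(4) by (simp add: insert_commute)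
    ultimately have "vs ! j = vs ! k" using key mx jk by metis
    then show False using jk l(2) by (simp add: nth_eq_iff_index_eq)
  qed
  ultimately show ?thesis using sg unfolding is_tree_def by blast
qed

text \<open>Induction on the rank: if \<open>{v, f v}\<close> were the edge that \<open>g\<close>
  assigns to \<open>f v\<close>, then \<open>g (f v) = v\<close>, so \<open>f (f v) = v\<close> by
  induction, and the rank would drop from \<open>v\<close> to \<open>f v\<close> and back to
  \<open>v\<close>.\<close>

lemma parent_edges_inj_on:
  "inj_on (\<lambda>f. (\<lambda>v. {v, f v}) ` (V - {r})) (parent_functions V E r)"
proof (rule inj_onI)
  fix f g
  assume f: "f \<in> parent_functions V E r" and g: "g \<in> parent_functions V E r"
    and eq: "(\<lambda>v. {v, f v}) ` (V - {r}) = (\<lambda>v. {v, g v}) ` (V - {r})"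
  obtain d :: "'a \<Rightarrow> nat" where d: "\<And>v. v \<in> V - {r} \<Longrightarrow> d (f v) < d v"
    using f unfolding parent_functions_def by blast
  have "f v = g v" if "v \<in> V - {r}" for v
    using that
  proof (induction "d v" arbitrary: v rule: less_induct)
    case less
    have "{v, f v} \<in> (\<lambda>v. {v, g v}) ` (V - {r})" using less.prems eq by blast
    then obtain u where "u \<in> V - {r}" "{v, f v} = {u, g u}" by blast
    then consider "f v = g v" | "f v \<in> V - {r}" "g (f v) = v"
      by (metis doubleton_eq_iff)
    then show ?case
    proof cases
      case 2
      then have "f (f v) = v" using less.hyps[of "f v"] d less.prems by simp
      then show ?thesis using d[OF less.prems] d[OF 2(1)] by simp
    qed
  qed
  then show "f = g" using f g unfolding parent_functions_def by (auto simp: fun_eq_iff) (metis)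
qed

text \<open>The parent of a vertex is a neighbour nearer to \<open>r\<close> in graph distance. The
  parent edges already form a spanning tree inside \<open>T\<close>, so a further edge of
  \<open>T\<close> would close a cycle.\<close>

lemma tree_has_parent_function:
  assumes "is_tree V T" "T \<subseteq> E" "r \<in> V"
  shows "\<exists>f\<in>parent_functions V E r. (\<lambda>v. {v, f v}) ` (V - {r}) = T"
proof -
  let ?R = "{(x, y). {x, y} \<in> T}"
  have sg: "simple_graph V T" and con: "\<And>u v. u \<in> V \<Longrightarrow> v \<in> V \<Longrightarrow> (u, v) \<in> ?R\<^sup>*"
    and acyc: "\<nexists>vs. graph_cycle T vs"
    using assms(1) unfolding is_tree_def graph_connected_def by auto
  define d where "d v = (LEAST k. (v, r) \<in> ?R ^^ k)" for v
  have "\<exists>w. {v, w} \<in> T \<and> d w < d v" if v: "v \<in> V - {r}" for v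
  proof -
    have "\<exists>k. (v, r) \<in> ?R ^^ k" using con[of v r] v assms(3) by (simp add: rtrancl_power)
    then have dv: "(v, r) \<in> ?R ^^ d v" unfolding d_def by (rule LeastI_ex)
    moreover have "d v \<noteq> 0" using dv v by (metis DiffD2 insertI1 pair_in_Id_conv relpow.simps(1))
    ultimately obtain k where k: "d v = Suc k" "(v, r) \<in> ?R ^^ Suc k"
      by (metis not0_implies_Suc)
    then obtain w where "(v, w) \<in> ?R" "(w, r) \<in> ?R ^^ k" using relpow_Suc_D2 by metis
    moreover have "d w \<le> k" unfolding d_def by (rule Least_le) fact
    ultimately show ?thesis using k(1) by auto
  qed
  then obtain g where g: "\<And>v. v \<in> V - {r} \<Longrightarrow> {v, g v} \<in> T \<and> d (g v) < d v" by metis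
  define f where "f v = (if v \<in> V - {r} then g v else v)" for v
  have f: "f \<in> parent_functions V T r"
    using g unfolding parent_functions_def f_def by auto
  let ?F = "(\<lambda>v. {v, f v}) ` (V - {r})"
  have FT: "?F \<subseteq> T" using g by (auto simp: f_def)
  have F: "is_tree V ?F" by (rule parent_edges_is_tree[OF sg assms(3) f])
  have "T \<subseteq> ?F"
  proof (rule ccontr)
    assume "\<not> T \<subseteq> ?F"
    then obtain e where e: "e \<in> T" "e \<notin> ?F" by blast
    then obtain x y where xy: "e = {x, y}" "x \<in> V" "y \<in> V" "x \<noteq> y"
      using sg unfolding simple_graph_def by blast
    have "(x, y) \<in> {(x, y). {x, y} \<in> ?F}\<^sup>*"
      using F xy unfolding is_tree_def graph_connected_def by blast
    moreover have "{(x, y). {x, y} \<in> ?F} \<subseteq> {(u, v). {u, v} \<in> T - {{x, y}}}"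
      using FT e xy(1) by auto
    ultimately have "(x, y) \<in> {(u, v). {u, v} \<in> T - {{x, y}}}\<^sup>*"
      by (meson rtrancl_mono subsetD)
    then show False using graph_cycle_if_edge_redundant acyc e(1) xy by metis
  qed
  moreover have "f \<in> parent_functions V E r"
    using f assms(2) unfolding parent_functions_def by blast
  ultimately show ?thesis using FT by blast
qed

lemma num_spanning_trees_eq_card_parent_functions:
  assumes "simple_graph V E" "r \<in> V"
  shows "num_spanning_trees V E = card (parent_functions V E r)"
proof -
  have im: "(\<lambda>f. (\<lambda>v. {v, f v}) ` (V - {r})) ` parent_functions V E r = {T. T \<subseteq> E \<and> is_tree V T}"
  proof (intro equalityI subsetI)
    fix T assume "T \<in> (\<lambda>f. (\<lambda>v. {v, f v}) ` (V - {r})) ` parent_functions V E r"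
    then show "T \<in> {T. T \<subseteq> E \<and> is_tree V T}"
      using parent_edges_is_tree[OF assms] by (auto simp: parent_functions_def)
  next
    fix T assume "T \<in> {T. T \<subseteq> E \<and> is_tree V T}"
    then show "T \<in> (\<lambda>f. (\<lambda>v. {v, f v}) ` (V - {r})) ` parent_functions V E r"
      using tree_has_parent_function[of V T E r] assms(2) by blast
  qed
  show ?thesis
    unfolding num_spanning_trees_def im[symmetric] by (rule card_image[OF parent_edges_inj_on])
qed

section \<open>Invariance under relabelling of the vertices\<close>

lemma is_tree_image:
  assumes "inj_on \<phi> V" "is_tree V T"
  shows "is_tree (\<phi> ` V) ((`) \<phi> ` T)"
proof -
  let ?T = "(`) \<phi> ` T"
  have sg: "simple_graph V T" and ne: "V \<noteq> {}"
    and con: "\<And>u v. u \<in> V \<Longrightarrow> v \<in> V \<Longrightarrow> (u, v) \<in> {(x, y). {x, y} \<in> T}\<^sup>*"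
    and acyc: "\<nexists>vs. graph_cycle T vs"
    using assms(2) unfolding is_tree_def graph_connected_def by auto
  have TV: "{x, y} \<in> T \<Longrightarrow> x \<in> V \<and> y \<in> V \<and> x \<noteq> y" for x y
    using sg unfolding simple_graph_def by (auto simp: doubleton_eq_iff)
  have "simple_graph (\<phi> ` V) ?T"
    unfolding simple_graph_def
  proof (intro conjI subsetI)
    show "finite (\<phi> ` V)" using sg unfolding simple_graph_def by blast
    fix e assume "e \<in> ?T"
    then obtain x y where "e = {\<phi> x, \<phi> y}" "{x, y} \<in> T"
      using sg unfolding simple_graph_def by auto
    then show "e \<in> {{u, v} |u v. u \<in> \<phi> ` V \<and> v \<in> \<phi> ` V \<and> u \<noteq> v}"
      using TV[of x y] assms(1) by (auto dest: inj_onD)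
  qed
  moreover have "graph_connected (\<phi> ` V) ?T"
  proof -
    have "(\<phi> u, \<phi> v) \<in> {(x, y). {x, y} \<in> ?T}\<^sup>*" if "(u, v) \<in> {(x, y). {x, y} \<in> T}\<^sup>*" for u v
      using that
    proof (induction rule: rtrancl_induct)
      case (step y z)
      have "(\<phi> y, \<phi> z) \<in> {(x, y). {x, y} \<in> ?T}"
        using step.hyps(2) by (auto intro!: image_eqI[of _ _ "{y, z}"])
      then show ?case using step.IH by (rule rtrancl_into_rtrancl[rotated])
    qed simp
    then show ?thesis using con ne unfolding graph_connected_def by auto
  qed
  moreover have "\<not> graph_cycle ?T vs" for vs
  proof
    assume c: "graph_cycle ?T vs"
    let ?\<psi> = "inv_into V \<phi>"
    have inv: "?\<psi> ` e \<in> T" if "e \<in> ?T" for e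
    proof -
      from that obtain e' where e': "e = \<phi> ` e'" "e' \<in> T" by auto
      then have "e' \<subseteq> V" using sg unfolding simple_graph_def by auto
      then show ?thesis using e' assms(1) by simp
    qed
    have edge: "{vs ! i, vs ! (Suc i mod length vs)} \<in> ?T" if "i < length vs" for i
      using c that unfolding graph_cycle_def by blast
    have "set vs \<subseteq> \<phi> ` V"
    proof
      fix x assume "x \<in> set vs"
      then obtain i where "i < length vs" "vs ! i = x" by (metis in_set_conv_nth)
      then have "x \<in> {vs ! i, vs ! (Suc i mod length vs)}"
        "{vs ! i, vs ! (Suc i mod length vs)} \<in> ?T" using edge by auto
      then show "x \<in> \<phi> ` V" using sg unfolding simple_graph_def by blast
    qed
    then have "distinct (map ?\<psi> vs)"
      using c inj_on_inv_into[of "set vs" \<phi> V] unfolding graph_cycle_def by (simp add: distinct_map)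
    moreover have "{map ?\<psi> vs ! i, map ?\<psi> vs ! (Suc i mod length vs)} \<in> T" if "i < length vs" for i
    proof -
      have "Suc i mod length vs < length vs" using that by (cases vs) auto
      then show ?thesis using inv[OF edge[OF that]] that by simp
    qed
    ultimately have "graph_cycle T (map ?\<psi> vs)" using c unfolding graph_cycle_def by simp
    then show False using acyc by blast
  qed
  ultimately show ?thesis unfolding is_tree_def by blast
qed

text \<open>Taking images is a bijection between the two sets of spanning trees, by
  \<open>is_tree_image\<close> for \<open>\<phi>\<close> and for its inverse. As edges lie in
  \<open>V\<close>, the inverse undoes the image edge by edge.\<close>

lemma num_spanning_trees_image:
  assumes "inj_on \<phi> V" "\<And>e. e \<in> E \<Longrightarrow> e \<subseteq> V"
  shows "num_spanning_trees (\<phi> ` V) ((`) \<phi> ` E) = num_spanning_trees V E"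
proof -
  let ?\<psi> = "inv_into V \<phi>"
  have inv: "(`) ?\<psi> ` (`) \<phi> ` T = T" if "T \<subseteq> E" for T
  proof -
    have "?\<psi> ` \<phi> ` e = e" if "e \<in> T" for e
      using assms(1) assms(2)[of e] that \<open>T \<subseteq> E\<close> by (intro inv_into_image_cancel) auto
    then show ?thesis by (simp add: image_image)
  qed
  have im: "(`) ((`) \<phi>) ` {T. T \<subseteq> E \<and> is_tree V T} = {T. T \<subseteq> (`) \<phi> ` E \<and> is_tree (\<phi> ` V) T}"
  proof (intro equalityI subsetI)
    fix S assume S: "S \<in> {T. T \<subseteq> (`) \<phi> ` E \<and> is_tree (\<phi> ` V) T}"
    then obtain T where T: "S = (`) \<phi> ` T" "T \<subseteq> E" by (auto simp: subset_image_iff)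
    have "is_tree (?\<psi> ` \<phi> ` V) ((`) ?\<psi> ` S)"
      using S inj_on_inv_into[of "\<phi> ` V" \<phi> V] by (intro is_tree_image) auto
    then have "is_tree V T" using inv[OF T(2)] T(1) assms(1) by simp
    then show "S \<in> (`) ((`) \<phi>) ` {T. T \<subseteq> E \<and> is_tree V T}" using T by blast
  qed (use is_tree_image[OF assms(1)] in auto)
  have "inj_on ((`) ((`) \<phi>)) {T. T \<subseteq> E \<and> is_tree V T}"
    by (rule inj_on_inverseI[where g = "(`) ((`) ?\<psi>)"]) (use inv in auto)
  from card_image[OF this] show ?thesis unfolding num_spanning_trees_def im .
qed

section \<open>The matrix-tree theorem\<close>

lemma det_zero_row:
  assumes "A \<in> carrier_mat n n" "k < n" "\<And>j. j < n \<Longrightarrow> A $$ (k, j) = 0"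
  shows "det A = 0"
  unfolding det_def'[OF assms(1)]
proof (rule sum.neutral, safe)
  fix q assume "q permutes {0..<n}"
  then have "q k < n" using assms(2) permutes_in_image[of q "{0..<n}" k] by simp
  then have "(\<Prod>i = 0..<n. A $$ (i, q i)) = 0"
    using assms(2,3) by (intro prod_zero bexI[of _ k]) auto
  then show "signof q * (\<Prod>i = 0..<n. A $$ (i, q i)) = 0" by simp
qed

text \<open>Laplacian of the digraph with one arc from \<open>i\<close> to \<open>f i\<close> per
  non-root vertex, rooted at 0: the matrix arising from a single choice of edges.\<close>

definition functional_laplacian :: "nat \<Rightarrow> (nat \<Rightarrow> nat) \<Rightarrow> real mat" where
  "functional_laplacian N f =
     mat N N (\<lambda>(i, j). of_bool (j = i) - (if i = 0 then 0 else of_bool (j = f i)))"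

text \<open>Only the identity contributes to the Leibniz sum. For another permutation
  \<open>q\<close>, let \<open>i\<close> be a moved point of least rank: \<open>q i\<close> is moved
  too, so its rank is not below that of \<open>i\<close>. Hence \<open>i\<close> is the root or
  \<open>q i \<noteq> f i\<close>, and the factor at \<open>i\<close> vanishes.\<close>

lemma det_functional_laplacian_acyclic:
  assumes d: "\<And>v. v \<in> {0..<N} - {0} \<Longrightarrow> d (f v) < (d v :: nat)"
  shows "det (functional_laplacian N f) = 1"
proof -
  let ?L = "functional_laplacian N f"
  have c: "?L \<in> carrier_mat N N" by (simp add: functional_laplacian_def)
  have zero: "(\<Prod>i = 0..<N. ?L $$ (i, q i)) = 0" if q: "q permutes {0..<N}" "q \<noteq> id" for q
  proof -
    have "\<exists>k. q k \<noteq> k" using q(2) by (auto simp: fun_eq_iff)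
    then obtain i where i: "q i \<noteq> i" and mn: "\<And>j. q j \<noteq> j \<Longrightarrow> d i \<le> d j"
      using ex_has_least_nat[of "\<lambda>k. q k \<noteq> k" _ d] by blast
    have iN: "i < N" using i q(1) by (metis atLeastLessThan_iff permutes_def zero_le)
    then have qN: "q i < N" using q(1) permutes_in_image[of q "{0..<N}" i] by simp
    have "q (q i) \<noteq> q i" using i permutes_inj[OF q(1)] by (simp add: inj_eq)
    then have "d i \<le> d (q i)" by (rule mn)
    then have "i = 0 \<or> q i \<noteq> f i" using d[of i] iN by force
    then have "?L $$ (i, q i) = 0" using i iN qN by (auto simp: functional_laplacian_def)
    then show ?thesis using iN by (intro prod_zero bexI[of _ i]) auto
  qed
  have "i = 0 \<or> i \<noteq> f i" if "i < N" for i using d[of i] that by force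
  then have "?L $$ (i, i) = 1" if "i < N" for i
    using that unfolding functional_laplacian_def by fastforce
  then have diag: "(\<Prod>i = 0..<N. ?L $$ (i, i)) = 1" by (intro prod.neutral) auto
  have "det ?L = (\<Sum>q\<in>{id}. signof q * (\<Prod>i = 0..<N. ?L $$ (i, q i)))"
    unfolding det_def'[OF c]
    by (rule sum.mono_neutral_right) (auto simp: finite_permutations permutes_id zero)
  then show ?thesis by (simp add: diag)
qed

text \<open>If all points reached 0, the number of steps would be a rank. So the set
  \<open>C\<close> of points never reaching 0 is nonempty; for \<open>v \<noteq> 0\<close> it
  contains both or neither of \<open>v\<close> and \<open>f v\<close>, so its indicator lies in the
  kernel.\<close>

lemma det_functional_laplacian_cyclic:
  assumes f: "\<And>v. v < N \<Longrightarrow> f v < N" "f 0 = 0"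
    and nd: "\<nexists>d :: nat \<Rightarrow> nat. \<forall>v\<in>{0..<N} - {0}. d (f v) < d v"
  shows "det (functional_laplacian N f) = 0"
proof -
  let ?L = "functional_laplacian N f"
  have c: "?L \<in> carrier_mat N N" by (simp add: functional_laplacian_def)
  define C where "C = {v. v < N \<and> (\<forall>k. (f ^^ k) v \<noteq> 0)}"
  have step: "f v \<in> C \<longleftrightarrow> v \<in> C" if "v < N" "v \<noteq> 0" for v
  proof -
    have "(\<forall>k. (f ^^ k) (f v) \<noteq> 0) \<longleftrightarrow> (\<forall>k. (f ^^ Suc k) v \<noteq> 0)"
      by (simp add: funpow_swap1)
    also have "\<dots> \<longleftrightarrow> (\<forall>k. (f ^^ k) v \<noteq> 0)"
      using that(2) by (metis funpow_0 not0_implies_Suc)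
    finally show ?thesis using f(1) that(1) unfolding C_def by blast
  qed
  have C0: "0 \<notin> C" by (auto simp: C_def intro: exI[of _ 0])
  have "C \<noteq> {}"
  proof
    assume e: "C = {}"
    define d where "d v = (LEAST k. (f ^^ k) v = 0)" for v
    have "d (f v) < d v" if v: "v \<in> {0..<N} - {0}" for v
    proof -
      have "\<exists>k. (f ^^ k) v = 0" using e v by (auto simp: C_def)
      then have dv: "(f ^^ d v) v = 0" unfolding d_def by (rule LeastI_ex)
      then have "d v \<noteq> 0" using v by (intro notI) simp
      then obtain k where k: "d v = Suc k" by (metis not0_implies_Suc)
      then have "(f ^^ k) (f v) = 0" using dv by (simp add: funpow_swap1)
      then have "d (f v) \<le> k" unfolding d_def by (rule Least_le)
      then show ?thesis using k by simp
    qed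
    then show False using nd by blast
  qed
  then obtain w where w: "w \<in> C" by blast
  then have wN: "w < N" by (simp add: C_def)
  let ?x = "vec N (\<lambda>i. of_bool (i \<in> C)) :: real vec"
  have "?x \<noteq> 0\<^sub>v N"
  proof
    assume "?x = 0\<^sub>v N"
    then have "?x $ w = 0\<^sub>v N $ w" by simp
    then show False using w wN by simp
  qed
  moreover have "?L *\<^sub>v ?x = 0\<^sub>v N"
  proof (rule eq_vecI)
    fix i assume "i < dim_vec (0\<^sub>v N :: real vec)"
    then have i: "i < N" by simp
    have "(?L *\<^sub>v ?x) $ i =
      (\<Sum>j = 0..<N. (of_bool (j = i) - (if i = 0 then 0 else of_bool (j = f i))) * of_bool (j \<in> C))"
      using i by (simp add: functional_laplacian_def scalar_prod_def)
    also have "\<dots> = (\<Sum>j = 0..<N. (if j = i then of_bool (i \<in> C) else 0) -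
        (if j = f i then if i = 0 then 0 else of_bool (f i \<in> C) else 0))"
      by (intro sum.cong) auto
    also have "\<dots> = of_bool (i \<in> C) - (if i = 0 then 0 else of_bool (f i \<in> C))"
      using i f(1)[OF i] by (simp add: sum_subtractf)
    also have "\<dots> = 0" using step[OF i] C0 by auto
    finally show "(?L *\<^sub>v ?x) $ i = 0\<^sub>v N $ i" using i by simp
  qed (simp add: functional_laplacian_def)
  ultimately show ?thesis
    using det_0_iff_vec_prod_zero_field[OF c] by (metis vec_carrier)
qed

text \<open>Expansion along the unit row gives the usual reduced Laplacian minor, while the index
  range stays \<open>{0..<N}\<close>.\<close>

definition rooted_laplacian :: "nat \<Rightarrow> nat set set \<Rightarrow> real mat" where
  "rooted_laplacian N E = mat N N (\<lambda>(i, j).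
     if i = 0 then of_bool (j = 0)
     else if i = j then (\<Sum>k = 0..<N. of_bool ({i, k} \<in> E)) else - of_bool ({i, j} \<in> E))"

text \<open>Each row of the Laplacian is a sum over the edges at its vertex, so by multilinearity
  the determinant is a sum over all choices of one edge per non-root vertex.\<close>

theorem matrix_tree:
  assumes sg: "simple_graph {0..<N} E" and N: "0 < N"
  shows "real (num_spanning_trees {0..<N} E) = det (rooted_laplacian N E)"
proof -
  \<comment> \<open>Contribution of the edge \<open>{i, j}\<close> to row \<open>i\<close>. In row 0
    the whole unit vector is assigned to \<open>j = 0\<close>, so that choices with
    \<open>f 0 \<noteq> 0\<close> contribute nothing.\<close>
  define a :: "nat \<Rightarrow> nat \<Rightarrow> real vec" where
    "a i j = vec N (\<lambda>k. if i = 0 then of_bool (j = 0 \<and> k = 0)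
       else of_bool ({i, j} \<in> E) * (of_bool (k = i) - of_bool (k = j)))" for i j
  have loop: "{i, i} \<notin> E" for i
    using sg by (auto simp: simple_graph_def doubleton_eq_iff)
  have EN: "{i, j} \<in> E \<Longrightarrow> j < N" for i j
    using sg by (auto simp: simple_graph_def doubleton_eq_iff)
  have rows: "rooted_laplacian N E =
      mat\<^sub>r N N (\<lambda>i. finsum_vec TYPE(real) N (a i) {0..<N})"
  proof (rule eq_matI)
    fix i k
    assume "i < dim_row (mat\<^sub>r N N (\<lambda>i. finsum_vec TYPE(real) N (a i) {0..<N}))"
      "k < dim_col (mat\<^sub>r N N (\<lambda>i. finsum_vec TYPE(real) N (a i) {0..<N}))"
    then have ik: "i < N" "k < N" by simp_all
    have "mat\<^sub>r N N (\<lambda>i. finsum_vec TYPE(real) N (a i) {0..<N}) $$ (i, k)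
        = (\<Sum>j = 0..<N. a i j $ k)"
      using ik by (simp, subst index_finsum_vec) (auto simp: a_def)
    also have "\<dots> = rooted_laplacian N E $$ (i, k)"
    proof (cases "i = 0")
      case True
      then have "(\<Sum>j = 0..<N. a i j $ k) = (\<Sum>j = 0..<N. if j = 0 then of_bool (k = 0) else 0)"
        using ik by (intro sum.cong) (auto simp: a_def)
      then show ?thesis using True ik by (simp add: rooted_laplacian_def)
    next
      case False
      have "(\<Sum>j = 0..<N. a i j $ k) =
          (\<Sum>j = 0..<N. of_bool ({i, j} \<in> E) * of_bool (k = i) -
             (if j = k then of_bool ({i, k} \<in> E) else 0))"
        using ik False by (intro sum.cong) (auto simp: a_def)
      also have "\<dots> = (\<Sum>j = 0..<N. of_bool ({i, j} \<in> E)) * of_bool (k = i) - of_bool ({i, k} \<in> E)"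
        using ik by (simp add: sum_subtractf sum_distrib_right)
      finally show ?thesis using False ik loop by (auto simp: rooted_laplacian_def)
    qed
    finally show "rooted_laplacian N E $$ (i, k) =
        mat\<^sub>r N N (\<lambda>i. finsum_vec TYPE(real) N (a i) {0..<N}) $$ (i, k)" by simp
  qed (simp_all add: rooted_laplacian_def)
  \<comment> \<open>The choice functions, in the form of the index set of
    \<open>det_linear_rows_sum\<close>.\<close>
  let ?F = "{f. (\<forall>i\<in>{0..<N}. f i \<in> {0..<N}) \<and> (\<forall>i. i \<notin> {0..<N} \<longrightarrow> f i = i)}"
  let ?P = "parent_functions {0..<N} E 0"
  have finF: "finite ?F"
  proof -
    have "?F \<subseteq> (\<lambda>g i. if i < N then g i else i) ` PiE {0..<N} (\<lambda>_. {0..<N})"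
    proof
      fix f assume f: "f \<in> ?F"
      then have "f = (\<lambda>i. if i < N then restrict f {0..<N} i else i)"
        by (auto simp: fun_eq_iff)
      moreover have "restrict f {0..<N} \<in> PiE {0..<N} (\<lambda>_. {0..<N})" using f by auto
      ultimately show "f \<in> (\<lambda>g i. if i < N then g i else i) ` PiE {0..<N} (\<lambda>_. {0..<N})" by blast
    qed
    then show ?thesis by (rule finite_subset) (intro finite_imageI finite_PiE, auto)
  qed
  have PF: "?P \<subseteq> ?F"
  proof
    fix f assume "f \<in> ?P"
    then have "f i < N" if "i < N" for i
      using that EN[of i "f i"] N by (cases "i = 0") (auto simp: parent_functions_def)
    then show "f \<in> ?F" using \<open>f \<in> ?P\<close> by (auto simp: parent_functions_def)
  qed
  have val: "det (mat\<^sub>r N N (\<lambda>i. a i (f i))) = of_bool (f \<in> ?P)" if f: "f \<in> ?F" for f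
  proof -
    let ?A = "mat\<^sub>r N N (\<lambda>i. a i (f i))"
    have c: "?A \<in> carrier_mat N N" by simp
    show ?thesis
    proof (cases "f 0 = 0 \<and> (\<forall>v\<in>{0..<N} - {0}. {v, f v} \<in> E)")
      case True
      have A: "?A = functional_laplacian N f"
        by (rule eq_matI) (use True in \<open>auto simp: a_def functional_laplacian_def\<close>)
      show ?thesis
      proof (cases "\<exists>d :: nat \<Rightarrow> nat. \<forall>v\<in>{0..<N} - {0}. d (f v) < d v")
        case d: True
        then have "f \<in> ?P" using True f by (auto simp: parent_functions_def)
        moreover obtain d :: "nat \<Rightarrow> nat" where "\<And>v. v \<in> {0..<N} - {0} \<Longrightarrow> d (f v) < d v"
          using d by blast
        then have "det ?A = 1" unfolding A by (rule det_functional_laplacian_acyclic)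
        ultimately show ?thesis by simp
      next
        case False
        then have "f \<notin> ?P" by (auto simp: parent_functions_def)
        then show ?thesis using False True f det_functional_laplacian_cyclic[of N f] A by simp
      qed
    next
      case False
      then have P: "f \<notin> ?P" by (auto simp: parent_functions_def)
      from False obtain k where "k < N" "\<And>j. j < N \<Longrightarrow> ?A $$ (k, j) = 0"
        using N by (cases "f 0 = 0") (force simp: a_def)+
      then have "det ?A = 0" by (rule det_zero_row[OF c])
      then show ?thesis using P by simp
    qed
  qed
  have "det (rooted_laplacian N E) = (\<Sum>f\<in>?F. det (mat\<^sub>r N N (\<lambda>i. a i (f i))))"
    unfolding rows by (rule det_linear_rows_sum) (auto simp: a_def)
  also have "\<dots> = (\<Sum>f\<in>?F. of_bool (f \<in> ?P))" using val by (intro sum.cong) auto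
  also have "\<dots> = (\<Sum>f\<in>?P. 1)"
    by (rule sum.mono_neutral_cong_right) (use finF PF in auto)
  finally show ?thesis
    using num_spanning_trees_eq_card_parent_functions[OF sg, of 0] N by simp
qed

section \<open>Rank-one updates of determinants\<close>

text \<open>Entry functions let rank-one updates be written entrywise, without carrier
  conditions.\<close>

definition fdet :: "nat \<Rightarrow> (nat \<Rightarrow> nat \<Rightarrow> real) \<Rightarrow> real" where
  "fdet N a = det (mat N N (\<lambda>(i, j). a i j))"

lemma fdet_cong:
  assumes "\<And>i j. i < N \<Longrightarrow> j < N \<Longrightarrow> a i j = b i j"
  shows "fdet N a = fdet N b"
  unfolding fdet_def by (rule arg_cong[where f = det], rule eq_matI) (use assms in auto)

lemma fdet_mult: "fdet N a * fdet N b = fdet N (\<lambda>i j. \<Sum>k = 0..<N. a i k * b k j)"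
proof -
  have "mat N N (\<lambda>(i, j). a i j) * mat N N (\<lambda>(i, j). b i j) =
      mat N N (\<lambda>(i, j). \<Sum>k = 0..<N. a i k * b k j)"
    by (rule eq_matI) (auto simp: scalar_prod_def)
  then show ?thesis unfolding fdet_def by (metis det_mult mat_carrier)
qed

lemma fdet_transpose: "fdet N (\<lambda>i j. a j i) = fdet N a"
proof -
  have "mat N N (\<lambda>(i, j). a j i) = transpose_mat (mat N N (\<lambda>(i, j). a i j))"
    by (rule eq_matI) auto
  then show ?thesis unfolding fdet_def by (metis det_transpose mat_carrier)
qed

lemma fdet_lower_triangular:
  assumes "\<And>i j. i < j \<Longrightarrow> j < N \<Longrightarrow> a i j = 0"
  shows "fdet N a = (\<Prod>i = 0..<N. a i i)"
  unfolding fdet_def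
  by (subst det_lower_triangular[of N]) (use assms in \<open>auto simp: prod_list_diag_prod\<close>)

text \<open>Sylvester's identity \<open>det (I + X V) = det (I + V X)\<close> for a column
  \<open>X\<close> and a row \<open>V\<close>, read off from
  \<open>det (P * Z) = det (Z * P)\<close>, where both products are block upper triangular.\<close>

lemma fdet_one_plus_outer:
  "fdet N (\<lambda>i j. of_bool (i = j) + x i * v j) = 1 + (\<Sum>k = 0..<N. v k * x k)"
proof -
  define X V :: "real mat" where "X = mat N 1 (\<lambda>(i, j). x i)" and "V = mat 1 N (\<lambda>(i, j). v j)"
  have c: "X \<in> carrier_mat N 1" "V \<in> carrier_mat 1 N" by (simp_all add: X_def V_def)
  define P Z where "P = four_block_mat (1\<^sub>m 1) (0\<^sub>m 1 N) (- X) (1\<^sub>m N)"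
    and "Z = four_block_mat (1\<^sub>m 1) (- V) X (1\<^sub>m N)"
  have PZ: "P \<in> carrier_mat (1 + N) (1 + N)" "Z \<in> carrier_mat (1 + N) (1 + N)"
    unfolding P_def Z_def using c by (auto intro!: four_block_carrier_mat)
  have "P * Z = four_block_mat (1\<^sub>m 1) (- V) (0\<^sub>m N 1) (1\<^sub>m N + X * V)"
    unfolding P_def Z_def using c
    by (subst mult_four_block_mat[of _ 1 1 _ N _ N _ _ 1 _ N])
       (auto intro!: arg_cong2[where f = "four_block_mat _ _"] simp: comm_add_mat)
  moreover have "Z * P = four_block_mat (1\<^sub>m 1 + V * X) (- V) (0\<^sub>m N 1) (1\<^sub>m N)"
    unfolding P_def Z_def using c
    by (subst mult_four_block_mat[of _ 1 1 _ N _ N _ _ 1 _ N])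
       (auto intro!: arg_cong2[where f = "four_block_mat _ _"] simp: comm_add_mat)
  moreover have "det (P * Z) = det (Z * P)" using det_mult[OF PZ] det_mult[OF PZ(2,1)] by simp
  ultimately have "det (1\<^sub>m N + X * V) = det (1\<^sub>m 1 + V * X)"
    using c by (simp add: det_four_block_mat_lower_left_zero[of _ 1 _ N])
  moreover have "1\<^sub>m N + X * V = mat N N (\<lambda>(i, j). of_bool (i = j) + x i * v j)"
    by (rule eq_matI) (auto simp: X_def V_def scalar_prod_def)
  moreover have "det (1\<^sub>m 1 + V * X) = 1 + (\<Sum>k = 0..<N. v k * x k)"
    using c by (subst det_single) (auto simp: X_def V_def scalar_prod_def)
  ultimately show ?thesis by (simp add: fdet_def)
qed

text \<open>The updated matrix is \<open>a (I + x v\<^sup>T)\<close>, so its determinant factors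
  even for singular \<open>a\<close>.\<close>

lemma fdet_add_column_multiple:
  "fdet N (\<lambda>i j. a i j + (\<Sum>k = 0..<N. a i k * x k) * v j) =
     fdet N a * (1 + (\<Sum>k = 0..<N. v k * x k))"
proof -
  have "(\<Sum>k = 0..<N. a i k * (of_bool (k = j) + x k * v j)) =
      a i j + (\<Sum>k = 0..<N. a i k * x k) * v j" if "j < N" for i j
  proof -
    have "(\<Sum>k = 0..<N. a i k * (of_bool (k = j) + x k * v j)) =
        (\<Sum>k = 0..<N. (if k = j then a i j else 0) + a i k * x k * v j)"
      by (intro sum.cong) (auto simp: algebra_simps)
    then show ?thesis using that by (simp add: sum.distrib sum_distrib_right)
  qed
  then show ?thesis
    unfolding fdet_one_plus_outer[symmetric] fdet_mult by (intro fdet_cong) simp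
qed

lemma fdet_add_row_multiple:
  "fdet N (\<lambda>i j. a i j + u i * (\<Sum>k = 0..<N. y k * a k j)) =
     fdet N a * (1 + (\<Sum>k = 0..<N. y k * u k))"
proof -
  have "fdet N (\<lambda>i j. a i j + u i * (\<Sum>k = 0..<N. y k * a k j)) =
      fdet N (\<lambda>i j. a j i + (\<Sum>k = 0..<N. a k i * y k) * u j)"
    by (subst fdet_transpose[symmetric]) (simp only: mult.commute)
  also have "\<dots> = fdet N (\<lambda>i j. a j i) * (1 + (\<Sum>k = 0..<N. u k * y k))"
    by (rule fdet_add_column_multiple)
  also have "\<dots> = fdet N a * (1 + (\<Sum>k = 0..<N. y k * u k))"
    unfolding fdet_transpose[of N a] by (simp only: mult.commute)
  finally show ?thesis .
qed

text \<open>Three updates start from the matrix with unit root row: the root row becomes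
  \<open>v\<close> (factor \<open>\<Sum>v\<close>), multiples of it are added to the other rows
  (factor 1), and the root row takes its final form (factor \<open>\<Sum>u\<close>).\<close>

lemma fdet_laplacian_plus_outer:
  assumes N: "0 < N"
    and rows: "\<And>i. i < N \<Longrightarrow> (\<Sum>j = 0..<N. l i j) = 0"
    and cols: "\<And>j. j < N \<Longrightarrow> (\<Sum>i = 0..<N. l i j) = 0"
  shows "fdet N (\<lambda>i j. l i j + u i * v j) =
    (\<Sum>i = 0..<N. u i) * (\<Sum>j = 0..<N. v j) * fdet N (\<lambda>i j. if i = 0 then of_bool (j = 0) else l i j)"
proof -
  let ?r = "\<lambda>i j. if i = 0 then of_bool (j = 0) else l i j"
  let ?s = "\<lambda>i j. if i = 0 then v j else l i j"
  let ?t = "\<lambda>i j. if i = 0 then v j else l i j + u i * v j"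
  have split: "(\<Sum>k = 0..<N. g k) = g 0 + (\<Sum>k\<in>{0..<N} - {0}. g k)" for g :: "nat \<Rightarrow> real"
    using N by (subst sum.remove[of _ 0]) auto
  have r1: "(\<Sum>k = 0..<N. ?r i k * 1) = of_bool (i = 0)" if "i < N" for i
    using rows[OF that] N by (auto simp: of_bool_def)
  \<comment> \<open>Rows of \<open>?r\<close> sum to 0, the root row to 1; hence the update touches
    only the root row.\<close>
  have "fdet N ?s = fdet N (\<lambda>i j. ?r i j + (\<Sum>k = 0..<N. ?r i k * 1) * (v j - of_bool (j = 0)))"
    by (rule fdet_cong, subst r1) auto
  also have "\<dots> = fdet N ?r * (1 + (\<Sum>k = 0..<N. (v k - of_bool (k = 0)) * 1))"
    by (rule fdet_add_column_multiple)
  also have "(\<Sum>k = 0..<N. (v k - of_bool (k = 0)) * 1) = (\<Sum>k = 0..<N. v k) - 1"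
    using N by (simp add: sum_subtractf of_bool_def)
  finally have s: "fdet N ?s = (\<Sum>k = 0..<N. v k) * fdet N ?r" by simp
  have "fdet N ?t = fdet N (\<lambda>i j. ?s i j +
      (if i = 0 then 0 else u i) * (\<Sum>k = 0..<N. of_bool (k = 0) * ?s k j))"
    by (rule fdet_cong, subst split) auto
  also have "\<dots> = fdet N ?s * (1 + (\<Sum>k = 0..<N. of_bool (k = 0) * (if k = 0 then 0 else u k)))"
    by (rule fdet_add_row_multiple)
  also have "(\<Sum>k = 0..<N. of_bool (k = 0) * (if k = 0 then 0 else u k)) = 0"
    by (rule sum.neutral) auto
  finally have t: "fdet N ?t = fdet N ?s" by simp
  \<comment> \<open>With these weights the rows of \<open>?t\<close> combine to
    \<open>l 0 + u 0 * v - v\<close>, the change required in row 0; vanishing column sums turn the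
    negated rows \<open>l k\<close> with \<open>k \<noteq> 0\<close> into
    \<open>l 0\<close>.\<close>
  define y where "y k = (if k = 0 then (\<Sum>i = 0..<N. u i) - 1 else - 1)" for k :: nat
  have row0: "(\<Sum>k = 0..<N. y k * ?t k j) = l 0 j + u 0 * v j - v j" if "j < N" for j
  proof -
    have "(\<Sum>k\<in>{0..<N} - {0}. y k * ?t k j) =
        (\<Sum>k\<in>{0..<N} - {0}. - l k j - u k * v j)"
      by (intro sum.cong) (auto simp: y_def)
    also have "\<dots> = - (\<Sum>k\<in>{0..<N} - {0}. l k j) - (\<Sum>k\<in>{0..<N} - {0}. u k) * v j"
      by (simp add: sum_subtractf sum_negf sum_distrib_right)
    also have "(\<Sum>k\<in>{0..<N} - {0}. l k j) = - l 0 j" using cols[OF that] split[of "\<lambda>k. l k j"] by simp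
    finally show ?thesis
      unfolding split[of "\<lambda>k. y k * ?t k j"] using split[of u] by (simp add: y_def algebra_simps)
  qed
  have "fdet N (\<lambda>i j. l i j + u i * v j) =
      fdet N (\<lambda>i j. ?t i j + of_bool (i = 0) * (\<Sum>k = 0..<N. y k * ?t k j))"
    by (rule fdet_cong, subst row0) auto
  also have "\<dots> = fdet N ?t * (1 + (\<Sum>k = 0..<N. y k * of_bool (k = 0)))"
    by (rule fdet_add_row_multiple)
  also have "(\<Sum>k = 0..<N. y k * of_bool (k = 0)) = (\<Sum>i = 0..<N. u i) - 1"
    by (subst split) (simp add: y_def)
  finally show ?thesis using s t by simp
qed

section \<open>The determinant of a nearly complete bipartite graph\<close>

text \<open>Rows and columns \<open>i < m\<close> belong to one side of the bipartition, the others to the other side,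
  and \<open>i\<close> is matched with \<open>i + m\<close> for \<open>i < p\<close>. The diagonal entries of matched vertices are
  parameters, so that the values where elimination divides by \<open>0\<close> (\<open>n = 1\<close> or \<open>m n = m + n\<close>) can
  be reached by a limit.\<close>

definition pair_diag :: "nat \<Rightarrow> nat \<Rightarrow> nat \<Rightarrow> real \<Rightarrow> real \<Rightarrow> nat \<Rightarrow> real" where
  "pair_diag m n p \<alpha> \<beta> i =
     (if i < m then if i < p then \<alpha> else real n else if i < m + p then \<beta> else real m)"

text \<open>This is \<open>M\<^sub>0\<close> for \<open>\<alpha> = n - 1\<close> and
  \<open>\<beta> = m - 1\<close>. Each summand is supported at one \<open>j\<close>, so sums along a
  row collapse. For \<open>i < m\<close> the truncated \<open>i - m\<close> is 0, and the guard
  \<open>m \<le> i\<close> removes the term.\<close>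

definition pair_entry :: "nat \<Rightarrow> nat \<Rightarrow> nat \<Rightarrow> real \<Rightarrow> real \<Rightarrow> nat \<Rightarrow> nat \<Rightarrow> real" where
  "pair_entry m n p \<alpha> \<beta> i j = (if j = i then pair_diag m n p \<alpha> \<beta> i else 0)
     + (if j = i + m then of_bool (i < p) else 0)
     + (if j = i - m then of_bool (m \<le> i \<and> i < m + p) else 0)"

lemma pair_entry_sum:
  assumes "p \<le> n" "i < m + n"
  shows "(\<Sum>k = 0..<m + n. pair_entry m n p \<alpha> \<beta> i k * x k) = pair_diag m n p \<alpha> \<beta> i * x i
    + of_bool (i < p) * x (i + m) + of_bool (m \<le> i \<and> i < m + p) * x (i - m)"
proof -
  have "(\<Sum>k = 0..<m + n. pair_entry m n p \<alpha> \<beta> i k * x k) =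
      (\<Sum>k = 0..<m + n. (if k = i then pair_diag m n p \<alpha> \<beta> i * x i else 0)
        + (if k = i + m then of_bool (i < p) * x (i + m) else 0)
        + (if k = i - m then of_bool (m \<le> i \<and> i < m + p) * x (i - m) else 0))"
    by (intro sum.cong) (auto simp: pair_entry_def algebra_simps)
  then show ?thesis using assms by (auto simp: sum.distrib)
qed

text \<open>Subtracting \<open>1 / \<alpha>\<close> times column \<open>j - m\<close> from each
  matched column \<open>j \<ge> m\<close> clears the entries above the diagonal and turns
  \<open>\<beta>\<close> into \<open>\<beta> - 1 / \<alpha>\<close>.\<close>

lemma fdet_pair_entry:
  assumes p: "p \<le> m" "p \<le> n" and \<alpha>: "\<alpha> \<noteq> 0"
  shows "fdet (m + n) (pair_entry m n p \<alpha> \<beta>) =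
    real n ^ (m - p) * real m ^ (n - p) * (\<alpha> * \<beta> - 1) ^ p"
proof -
  let ?N = "m + n"
  let ?a = "pair_entry m n p \<alpha> \<beta>"
  define e where "e k j = (if k = j then 1 else 0) -
    (if k = j - m then of_bool (m \<le> j \<and> j < m + p) / \<alpha> else 0)" for k j :: nat
  define t where "t i j = ?a i j - of_bool (m \<le> j \<and> j < m + p) / \<alpha> * ?a i (j - m)" for i j
  have e1: "fdet ?N e = 1"
  proof -
    have "fdet ?N (\<lambda>i j. e j i) = (\<Prod>i = 0..<?N. e i i)"
      using p by (intro fdet_lower_triangular) (auto simp: e_def)
    also have "\<dots> = 1" using p by (intro prod.neutral) (auto simp: e_def)
    finally show ?thesis unfolding fdet_transpose[of _ e] .
  qed
  have "(\<Sum>k = 0..<?N. ?a i k * e k j) = t i j" if "j < ?N" for i j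
  proof -
    have "(\<Sum>k = 0..<?N. ?a i k * e k j) = (\<Sum>k = 0..<?N. (if k = j then ?a i j else 0)
        - (if k = j - m then of_bool (m \<le> j \<and> j < m + p) / \<alpha> * ?a i (j - m) else 0))"
      by (intro sum.cong) (auto simp: e_def algebra_simps)
    then show ?thesis using that by (auto simp: sum_subtractf t_def)
  qed
  then have "fdet ?N ?a * fdet ?N e = fdet ?N t"
    unfolding fdet_mult by (intro fdet_cong) simp
  also have "fdet ?N t = (\<Prod>i = 0..<?N. t i i)"
    using p \<alpha> by (intro fdet_lower_triangular) (auto simp: t_def pair_entry_def pair_diag_def)
  also have "\<dots> = (\<Prod>i = 0..<?N. if i < m then if i < p then \<alpha> else real n
      else if i < m + p then (\<alpha> * \<beta> - 1) / \<alpha> else real m)"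
    using p \<alpha> by (intro prod.cong) (auto simp: t_def pair_entry_def pair_diag_def field_simps)
  also have "\<dots> = \<alpha> ^ p * real n ^ (m - p) * (((\<alpha> * \<beta> - 1) / \<alpha>) ^ p * real m ^ (n - p))"
  proof -
    let ?g = "\<lambda>i. if i < m then if i < p then \<alpha> else real n
      else if i < m + p then (\<alpha> * \<beta> - 1) / \<alpha> else real m"
    have "prod ?g {0..<p} * prod ?g {p..<m} = prod ?g {0..<m}"
      and "prod ?g {m..<m + p} * prod ?g {m + p..<?N} = prod ?g {m..<?N}"
      and "prod ?g {0..<m} * prod ?g {m..<?N} = prod ?g {0..<?N}"
      by (rule prod.atLeastLessThan_concat; use p in simp)+
    then have "prod ?g {0..<?N} = prod ?g {0..<p} * prod ?g {p..<m}
        * (prod ?g {m..<m + p} * prod ?g {m + p..<?N})"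
      by (simp only:)
    also have "prod ?g {0..<p} = (\<Prod>i = 0..<p. \<alpha>)"
      using p by (intro prod.cong) auto
    also have "prod ?g {p..<m} = (\<Prod>i = p..<m. real n)"
      by (intro prod.cong) auto
    also have "prod ?g {m..<m + p} = (\<Prod>i = m..<m + p. (\<alpha> * \<beta> - 1) / \<alpha>)"
      by (intro prod.cong) auto
    also have "prod ?g {m + p..<?N} = (\<Prod>i = m + p..<?N. real m)"
      by (intro prod.cong) auto
    finally show ?thesis by simp
  qed
  also have "\<dots> = real n ^ (m - p) * real m ^ (n - p) * (\<alpha> * \<beta> - 1) ^ p"
    using \<alpha> by (simp add: power_divide)
  finally show ?thesis by (simp add: e1)
qed

lemma fdet_pair_entry_minus_block_generic:
  assumes "0 < m" and p: "p \<le> m" "p \<le> n" and \<alpha>: "\<alpha> \<noteq> 0" and \<Gamma>: "\<alpha> * \<beta> \<noteq> 1"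
  shows "fdet (m + n) (\<lambda>i j. pair_entry m n p \<alpha> \<beta> i j - of_bool (m \<le> i \<and> j < m)) =
    real n ^ (m - p) * real m ^ (n - p) *
      (if p = 0 then 1 else (\<alpha> * \<beta> - 1) ^ (p - 1) * (\<alpha> * \<beta> - 1 + real p))"
proof -
  let ?N = "m + n" and ?\<Gamma> = "\<alpha> * \<beta> - 1"
  let ?a = "pair_entry m n p \<alpha> \<beta>"
  define x where "x k = (if k < m then if k < p then - 1 / ?\<Gamma> else 0
    else if k < m + p then \<alpha> / ?\<Gamma> else 1 / real m)" for k
  have ax: "(\<Sum>k = 0..<?N. ?a i k * x k) = of_bool (m \<le> i)" if "i < ?N" for i
    unfolding pair_entry_sum[OF p(2) that]
    using p \<Gamma> \<open>0 < m\<close> by (auto simp: x_def pair_diag_def divide_simps)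
  have vx: "(\<Sum>k = 0..<?N. - of_bool (k < m) * x k) = real p / ?\<Gamma>"
  proof -
    have "(\<Sum>k = 0..<?N. - of_bool (k < m) * x k) = (\<Sum>k = 0..<p. 1 / ?\<Gamma>)"
      by (rule sum.mono_neutral_cong_right) (use p in \<open>auto simp: x_def\<close>)
    then show ?thesis by simp
  qed
  have "fdet ?N (\<lambda>i j. ?a i j - of_bool (m \<le> i \<and> j < m)) =
      fdet ?N (\<lambda>i j. ?a i j + (\<Sum>k = 0..<?N. ?a i k * x k) * - of_bool (j < m))"
    by (rule fdet_cong, subst ax) auto
  also have "\<dots> = fdet ?N ?a * (1 + real p / ?\<Gamma>)"
    unfolding fdet_add_column_multiple vx ..
  also have "\<dots> = real n ^ (m - p) * real m ^ (n - p) * (?\<Gamma> ^ p * (1 + real p / ?\<Gamma>))"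
    unfolding fdet_pair_entry[OF p \<alpha>] by simp
  also have "?\<Gamma> ^ p * (1 + real p / ?\<Gamma>) = (if p = 0 then 1 else ?\<Gamma> ^ (p - 1) * (?\<Gamma> + real p))"
    using \<Gamma> by (cases p) (auto simp: field_simps)
  finally show ?thesis .
qed

text \<open>By the Leibniz formula the determinant is a polynomial in the entries.\<close>

lemma tendsto_fdet:
  assumes "\<And>i j. ((\<lambda>x. a x i j) \<longlongrightarrow> b i j) F"
  shows "((\<lambda>x. fdet N (a x)) \<longlongrightarrow> fdet N b) F"
proof -
  have "fdet N c = (\<Sum>q | q permutes {0..<N}. signof q * (\<Prod>i = 0..<N. c i (q i)))" for c
  proof -
    have "(\<Prod>i = 0..<N. mat N N (\<lambda>(i, j). c i j) $$ (i, q i)) = (\<Prod>i = 0..<N. c i (q i))"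
      if "q permutes {0..<N}" for q
      using permutes_in_image[OF that] by (intro prod.cong) auto
    then show ?thesis unfolding fdet_def by (subst det_def'[of _ N]) (auto intro!: sum.cong)
  qed
  then show ?thesis using assms by (simp add: tendsto_intros)
qed

text \<open>Both sides are continuous in \<open>\<alpha>\<close> and agree away from 0 and
  \<open>1 / \<beta>\<close>, hence everywhere.\<close>

lemma fdet_pair_entry_minus_block:
  assumes "0 < m" and p: "p \<le> m" "p \<le> n"
  shows "fdet (m + n) (\<lambda>i j. pair_entry m n p \<alpha> \<beta> i j - of_bool (m \<le> i \<and> j < m)) =
    real n ^ (m - p) * real m ^ (n - p) *
      (if p = 0 then 1 else (\<alpha> * \<beta> - 1) ^ (p - 1) * (\<alpha> * \<beta> - 1 + real p))"
    (is "?l \<alpha> = ?r \<alpha>")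
proof (rule tendsto_unique[of "at \<alpha>"])
  have "\<forall>\<^sub>F x in at \<alpha>. x \<noteq> 0 \<and> x \<noteq> 1 / \<beta>"
    by (intro eventually_conj) (metis eventually_at_filter eventually_neq_at_within)+
  then have "\<forall>\<^sub>F x in at \<alpha>. ?r x = ?l x"
  proof eventually_elim
    case (elim x)
    \<comment> \<open>For \<open>\<beta> = 0\<close> the convention \<open>1 / 0 = 0\<close> repeats
      the first exclusion, and the product is 0 anyway.\<close>
    then have "x * \<beta> \<noteq> 1" by (auto simp: eq_divide_eq split: if_splits)
    then show ?case using fdet_pair_entry_minus_block_generic[OF assms] elim by simp
  qed
  moreover have "(?r \<longlongrightarrow> ?r \<alpha>) (at \<alpha>)"
    by (cases "p = 0") (auto intro!: tendsto_intros)
  ultimately show "(?l \<longlongrightarrow> ?r \<alpha>) (at \<alpha>)" by (rule Lim_transform_eventually[rotated])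
  show "(?l \<longlongrightarrow> ?l \<alpha>) (at \<alpha>)"
  proof (intro tendsto_fdet)
    fix i j
    show "((\<lambda>x. pair_entry m n p x \<beta> i j - of_bool (m \<le> i \<and> j < m)) \<longlongrightarrow>
        pair_entry m n p \<alpha> \<beta> i j - of_bool (m \<le> i \<and> j < m)) (at \<alpha>)"
      by (auto simp: pair_entry_def pair_diag_def intro!: tendsto_intros)
  qed
qed simp

section \<open>Counting the spanning trees\<close>

text \<open>The indicators of the two sides, taken for \<open>u\<close> and \<open>v\<close> in
  \<open>fdet_laplacian_plus_outer\<close>, have sums \<open>m\<close> and \<open>n\<close>, the
  factor on the left. Matched vertices have degrees \<open>n - 1\<close> and \<open>m - 1\<close>,
  so \<open>\<alpha> * \<beta> - 1 = m n - m - n\<close>.\<close>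

lemma num_spanning_trees_standard:
  assumes "0 < m" "0 < n" and p: "p \<le> m" "p \<le> n"
  defines "E \<equiv> complete_bipartite_edges {0..<m} {m..<m + n} - (\<lambda>i. {i, i + m}) ` {0..<p}"
  shows "real m * real n * real (num_spanning_trees {0..<m + n} E) =
    real n ^ (m - p) * real m ^ (n - p) *
      (if p = 0 then 1 else (real m * real n - real m - real n) ^ (p - 1) *
         (real m * real n - real m - real n + real p))"
proof -
  let ?N = "m + n"
  have adj: "{i, j} \<in> E \<longleftrightarrow> (i < m \<and> m \<le> j \<and> j < ?N \<and> \<not> (i < p \<and> j = i + m)) \<or>
      (j < m \<and> m \<le> i \<and> i < ?N \<and> \<not> (j < p \<and> i = j + m))" for i j
    using p unfolding E_def complete_bipartite_edges_def
    by (auto simp: doubleton_eq_iff image_iff)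
  have loop: "{i, i} \<notin> E" for i unfolding adj by auto
  have sg: "simple_graph {0..<?N} E"
    unfolding simple_graph_def E_def complete_bipartite_edges_def by fastforce
  define l :: "nat \<Rightarrow> nat \<Rightarrow> real" where
    "l i j = (if i = j then (\<Sum>k = 0..<?N. of_bool ({i, k} \<in> E)) else - of_bool ({i, j} \<in> E))"
    for i j
  have rows: "(\<Sum>j = 0..<?N. l i j) = 0" if "i < ?N" for i
  proof -
    have "(\<Sum>j = 0..<?N. l i j) = (\<Sum>j = 0..<?N.
        (if j = i then \<Sum>k = 0..<?N. of_bool ({i, k} \<in> E) else 0) - of_bool ({i, j} \<in> E))"
      using loop by (intro sum.cong) (auto simp: l_def)
    then show ?thesis using that by (simp add: sum_subtractf)
  qed
  have "l i j = l j i" for i j by (simp add: l_def insert_commute)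
  then have cols: "(\<Sum>i = 0..<?N. l i j) = 0" if "j < ?N" for j using rows[OF that] by simp
  have diag: "l i i = pair_diag m n p (real n - 1) (real m - 1) i" if "i < ?N" for i
  proof (cases "i < m")
    case True
    have "l i i = (\<Sum>k = 0..<?N. of_bool (m \<le> k) - (if k = i + m then of_bool (i < p) else 0))"
      unfolding l_def if_P[OF refl] by (rule sum.cong) (use True in \<open>auto simp: adj\<close>)
    also have "\<dots> = (\<Sum>k = 0..<?N. of_bool (m \<le> k)) - of_bool (i < p)"
      using p True by (auto simp: sum_subtractf)
    also have "(\<Sum>k = 0..<?N. of_bool (m \<le> k)) = (\<Sum>k = m..<?N. 1 :: real)"
      by (rule sum.mono_neutral_cong_right) auto
    finally show ?thesis using True by (auto simp: pair_diag_def)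
  next
    case False
    have "l i i = (\<Sum>k = 0..<?N. of_bool (k < m) - (if k = i - m then of_bool (i < m + p) else 0))"
      unfolding l_def if_P[OF refl] by (rule sum.cong) (use False that p in \<open>auto simp: adj\<close>)
    also have "\<dots> = (\<Sum>k = 0..<?N. of_bool (k < m)) - of_bool (i < m + p)"
      using that by (auto simp: sum_subtractf)
    also have "(\<Sum>k = 0..<?N. of_bool (k < m)) = (\<Sum>k = 0..<m. 1 :: real)"
      by (rule sum.mono_neutral_cong_right) auto
    finally show ?thesis using False by (auto simp: pair_diag_def)
  qed
  \<comment> \<open>In the upper right block the added ones cancel the \<open>-1\<close> of each
    edge and leave 1 at deleted edges. The lower left block shows the same pattern with 1 subtracted
    everywhere.\<close>
  have entry: "l i j + of_bool (i < m) * of_bool (m \<le> j) =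
      pair_entry m n p (real n - 1) (real m - 1) i j - of_bool (m \<le> i \<and> j < m)"
    if "i < ?N" "j < ?N" for i j
  proof (cases "i = j")
    case True
    then show ?thesis using diag[OF that(1)] \<open>0 < m\<close> by (auto simp: pair_entry_def)
  next
    case False
    then show ?thesis using that p by (auto simp: l_def adj pair_entry_def)
  qed
  have "real (num_spanning_trees {0..<?N} E) =
      fdet ?N (\<lambda>i j. if i = 0 then of_bool (j = 0) else l i j)"
    using matrix_tree[OF sg] \<open>0 < m\<close> unfolding rooted_laplacian_def fdet_def l_def by simp
  moreover have "(\<Sum>i = 0..<?N. of_bool (i < m)) = (\<Sum>i = 0..<m. 1 :: real)"
    by (rule sum.mono_neutral_cong_right) auto
  moreover have "(\<Sum>i = 0..<?N. of_bool (m \<le> i)) = (\<Sum>i = m..<?N. 1 :: real)"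
    by (rule sum.mono_neutral_cong_right) auto
  ultimately have "real m * real n * real (num_spanning_trees {0..<?N} E) =
      fdet ?N (\<lambda>i j. l i j + of_bool (i < m) * of_bool (m \<le> j))"
    using fdet_laplacian_plus_outer[of ?N l, OF _ rows cols] \<open>0 < m\<close> by simp
  also have "\<dots> = fdet ?N
      (\<lambda>i j. pair_entry m n p (real n - 1) (real m - 1) i j - of_bool (m \<le> i \<and> j < m))"
    by (rule fdet_cong) (rule entry)
  also have "\<dots> = real n ^ (m - p) * real m ^ (n - p) *
      (if p = 0 then 1 else (real m * real n - real m - real n) ^ (p - 1) *
         (real m * real n - real m - real n + real p))"
  proof -
    have "(real n - 1) * (real m - 1) - 1 = real m * real n - real m - real n"
      by (simp add: algebra_simps)
    then show ?thesis using fdet_pair_entry_minus_block[OF \<open>0 < m\<close> p] by simp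
  qed
  finally show ?thesis .
qed

section \<open>A vertex labelling adapted to a matching\<close>

lemma extend_to_bij_betw:
  assumes "finite A" "inj_on a {0..<p}" "a ` {0..<p} \<subseteq> A"
  shows "\<exists>g. bij_betw g {0..<card A} A \<and> (\<forall>i<p. g i = a i)"
proof -
  have c: "card (a ` {0..<p}) = p" using assms(2) by (simp add: card_image)
  then have pA: "p \<le> card A" using assms(1,3) card_mono by metis
  have "card {p..<card A} = card (A - a ` {0..<p})"
    using assms(3) c by (simp add: card_Diff_subset)
  then obtain h where h: "bij_betw h {p..<card A} (A - a ` {0..<p})"
    using finite_same_card_bij[of "{p..<card A}" "A - a ` {0..<p}"] assms(1) by auto
  define g where "g i = (if i < p then a i else h i)" for i
  have "bij_betw g {0..<p} (a ` {0..<p})"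
    using assms(2) by (auto simp: bij_betw_def g_def inj_on_def)
  moreover have "bij_betw g {p..<card A} (A - a ` {0..<p})"
    using h by (subst bij_betw_cong[of _ g h]) (auto simp: g_def)
  ultimately have "bij_betw g ({0..<p} \<union> {p..<card A}) (a ` {0..<p} \<union> (A - a ` {0..<p}))"
    by (rule bij_betw_combine) auto
  moreover have "{0..<p} \<union> {p..<card A} = {0..<card A}" using pA by auto
  moreover have "a ` {0..<p} \<union> (A - a ` {0..<p}) = A" using assms(3) by auto
  ultimately show ?thesis by (auto simp: g_def)
qed

lemma complete_bipartite_edges_image:
  "complete_bipartite_edges (f ` A) (f ` B) = (`) f ` complete_bipartite_edges A B"
proof (intro equalityI subsetI)
  fix e assume "e \<in> complete_bipartite_edges (f ` A) (f ` B)"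
  then obtain a b where "a \<in> A" "b \<in> B" "e = f ` {a, b}"
    by (auto simp: complete_bipartite_edges_def)
  then show "e \<in> (`) f ` complete_bipartite_edges A B"
    unfolding complete_bipartite_edges_def by blast
qed (auto simp: complete_bipartite_edges_def)

text \<open>The matching edges are enumerated as \<open>{a i, b i}\<close>; disjointness makes
  \<open>a\<close> and \<open>b\<close> injective, so each extends to a numbering of its side, with
  the numbers for \<open>B\<close> shifted by \<open>card A\<close>.\<close>

lemma matching_standard_labelling:
  assumes "finite A" "finite B"
    and M: "graph_matching (complete_bipartite_edges A B) M"
  shows "\<exists>\<phi>. bij_betw \<phi> {0..<card A} A \<and> bij_betw \<phi> {card A..<card A + card B} B \<and>
    M = (\<lambda>i. {\<phi> i, \<phi> (i + card A)}) ` {0..<card M}"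
proof -
  let ?p = "card M"
  have sub: "M \<subseteq> complete_bipartite_edges A B" and disj: "pairwise disjnt M"
    using M unfolding graph_matching_def by auto
  have "complete_bipartite_edges A B \<subseteq> Pow (A \<union> B)"
    by (auto simp: complete_bipartite_edges_def)
  then have "finite M" using sub assms(1,2) by (meson finite_Pow_iff finite_UnI finite_subset)
  then obtain e where e: "bij_betw e {0..<?p} M" using ex_bij_betw_nat_finite by blast
  have "\<exists>x y. x \<in> A \<and> y \<in> B \<and> e i = {x, y}" if "i < ?p" for i
  proof -
    have "e i \<in> M" using bij_betwE[OF e] that by simp
    then show ?thesis using sub unfolding complete_bipartite_edges_def by blast
  qed
  then obtain a b where ab: "\<And>i. i < ?p \<Longrightarrow> a i \<in> A \<and> b i \<in> B \<and> e i = {a i, b i}" by metis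
  have inj: "i = j" if "i < ?p" "j < ?p" "e i \<inter> e j \<noteq> {}" for i j
  proof (rule ccontr)
    assume "i \<noteq> j"
    then have "e i \<noteq> e j" "e i \<in> M" "e j \<in> M"
      using inj_onD[OF bij_betw_imp_inj_on[OF e], of i j] bij_betwE[OF e] that(1,2) by auto
    then show False using disj that(3) unfolding pairwise_def disjnt_def by blast
  qed
  have ia: "inj_on a {0..<?p}" "a ` {0..<?p} \<subseteq> A" and ib: "inj_on b {0..<?p}" "b ` {0..<?p} \<subseteq> B"
  proof -
    show "inj_on a {0..<?p}"
      by (rule inj_onI, rule inj) (use ab in fastforce)+
    show "inj_on b {0..<?p}"
      by (rule inj_onI, rule inj) (use ab in fastforce)+
  qed (use ab in auto)
  obtain g where g: "bij_betw g {0..<card A} A" "\<And>i. i < ?p \<Longrightarrow> g i = a i"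
    using extend_to_bij_betw[OF assms(1) ia] by blast
  obtain h where h: "bij_betw h {0..<card B} B" "\<And>i. i < ?p \<Longrightarrow> h i = b i"
    using extend_to_bij_betw[OF assms(2) ib] by blast
  have pA: "?p \<le> card A"
    using card_mono[OF assms(1) ia(2)] ia(1) by (simp add: card_image)
  define \<phi> where "\<phi> i = (if i < card A then g i else h (i - card A))" for i
  have "bij_betw \<phi> {0..<card A} A"
    using g(1) by (subst bij_betw_cong[of _ \<phi> g]) (auto simp: \<phi>_def)
  moreover have "bij_betw \<phi> {card A..<card A + card B} B"
  proof -
    have "bij_betw (\<lambda>i. i - card A) {card A..<card A + card B} {0..<card B}"
      by (rule bij_betwI[where g = "\<lambda>i. i + card A"]) auto
    then have "bij_betw (h \<circ> (\<lambda>i. i - card A)) {card A..<card A + card B} B"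
      using h(1) by (rule bij_betw_trans)
    then show ?thesis
      by (subst bij_betw_cong[of _ \<phi> "h \<circ> (\<lambda>i. i - card A)"]) (auto simp: \<phi>_def)
  qed
  moreover have "M = (\<lambda>i. {\<phi> i, \<phi> (i + card A)}) ` {0..<?p}"
  proof -
    have "M = e ` {0..<?p}" using e by (simp add: bij_betw_def)
    also have "\<dots> = (\<lambda>i. {\<phi> i, \<phi> (i + card A)}) ` {0..<?p}"
      using ab g(2) h(2) pA by (intro image_cong) (auto simp: \<phi>_def)
    finally show ?thesis .
  qed
  ultimately show ?thesis by blast
qed

(* The product (mn-m-n+p)(mn-m-n)^(p-1) is undefined only for p = 0 and mn = m+n,
   that is m = n = 2; it is then read as 1, as for every other m, n with p = 0. *)
theorem theorem1p5:
  fixes A B :: "'a set" and M :: "'a set set" and m n p :: nat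
  assumes "m > 0" and "n > 0" and "p \<le> min m n"
    and "finite A" and "finite B" and "A \<inter> B = {}"
    and "card A = m" and "card B = n"
    and "graph_matching (complete_bipartite_edges A B) M" and "card M = p"
  shows "real (num_spanning_trees (A \<union> B) (complete_bipartite_edges A B - M)) =
    (if p = 0 \<and> m * n = m + n then 1
     else (real m * real n - real m - real n + real p)
          * (real m * real n - real m - real n) powi (int p - 1))
    * real m powi (int n - int p - 1) * real n powi (int m - int p - 1)"
proof -
  let ?E = "complete_bipartite_edges {0..<m} {m..<m + n}"
  let ?M = "(\<lambda>i. {i, i + m}) ` {0..<p}"
  let ?\<tau> = "real (num_spanning_trees (A \<union> B) (complete_bipartite_edges A B - M))"
  let ?\<Delta> = "real m * real n - real m - real n"
  obtain \<phi> where A: "bij_betw \<phi> {0..<m} A" and B: "bij_betw \<phi> {m..<m + n} B"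
    and M: "M = (\<lambda>i. {\<phi> i, \<phi> (i + m)}) ` {0..<p}"
    using matching_standard_labelling[OF assms(4,5,9)] assms(7,8,10) by blast
  have "bij_betw \<phi> ({0..<m} \<union> {m..<m + n}) (A \<union> B)"
    using A B assms(6) by (rule bij_betw_combine)
  moreover have "{0..<m} \<union> {m..<m + n} = {0..<m + n}" by auto
  ultimately have V: "inj_on \<phi> {0..<m + n}" "\<phi> ` {0..<m + n} = A \<union> B"
    by (simp_all add: bij_betw_def)
  have EV: "e \<subseteq> {0..<m + n}" if "e \<in> ?E" for e
    using that by (auto simp: complete_bipartite_edges_def)
  have "?M \<subseteq> ?E" using assms(3) by (force simp: complete_bipartite_edges_def)
  then have "?E \<union> ?M \<subseteq> Pow {0..<m + n}" using EV by blast
  then have "inj_on ((`) \<phi>) (?E \<union> ?M)"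
    using inj_on_image_Pow[OF V(1)] by (rule inj_on_subset[rotated])
  then have "(`) \<phi> ` (?E - ?M) = (`) \<phi> ` ?E - (`) \<phi> ` ?M"
    by (rule inj_on_image_set_diff) auto
  also have "(`) \<phi> ` ?M = M" unfolding M by (simp add: image_image)
  also have "(`) \<phi> ` ?E = complete_bipartite_edges A B"
    using A B by (simp add: bij_betw_def flip: complete_bipartite_edges_image)
  finally have "?\<tau> = real (num_spanning_trees {0..<m + n} (?E - ?M))"
    using num_spanning_trees_image[OF V(1), of "?E - ?M"] EV V(2) by auto
  then have main: "real m * real n * ?\<tau> = real n ^ (m - p) * real m ^ (n - p) *
      (if p = 0 then 1 else ?\<Delta> ^ (p - 1) * (?\<Delta> + real p))"
    using num_spanning_trees_standard[of m n p] assms(1-3) by simp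
  \<comment> \<open>The exponent is \<open>-1\<close> when \<open>l = p\<close>, hence the division
    by \<open>real k\<close>.\<close>
  have pow: "real k powi (int l - int p - 1) = real k ^ (l - p) / real k" if "0 < k" "p \<le> l" for k l
  proof -
    have "int l - int p - 1 = int (l - p) - 1" using that by simp
    then have "real k powi (int l - int p - 1) = real k powi (int (l - p) - 1)" by (simp only:)
    also have "\<dots> = real k powi int (l - p) / real k powi 1"
      by (rule power_int_diff) (use that in simp)
    finally show ?thesis by (simp only: power_int_of_nat power_int_1_right)
  qed
  have "(if p = 0 \<and> m * n = m + n then 1 else (?\<Delta> + real p) * ?\<Delta> powi (int p - 1)) =
      (if p = 0 then 1 else ?\<Delta> ^ (p - 1) * (?\<Delta> + real p))"
  proof (cases "p = 0")
    case True
    \<comment> \<open>For \<open>p = 0\<close> the product is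
      \<open>?\<Delta> * ?\<Delta> powi (- 1)\<close>, which is 1 unless
      \<open>?\<Delta> = 0\<close>, exactly the exceptional case of the statement.\<close>
    have "?\<Delta> = 0 \<longleftrightarrow> real (m * n) = real (m + n)" by auto
    then have "?\<Delta> = 0 \<longleftrightarrow> m * n = m + n" by (simp only: of_nat_eq_iff)
    then show ?thesis using True by (auto simp: power_int_minus)
  next
    case False
    then have "int p - 1 = int (p - 1)" by simp
    then show ?thesis using False by (simp only: power_int_of_nat) simp
  qed
  moreover have "?\<tau> = (if p = 0 then 1 else ?\<Delta> ^ (p - 1) * (?\<Delta> + real p))
      * (real m ^ (n - p) / real m) * (real n ^ (m - p) / real n)"
    using main assms(1,2) by (simp add: field_simps)
  ultimately show ?thesis using assms(1-3) by (simp only: pow min.bounded_iff)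
qed

end
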